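(* Let $p$ be an odd prime and let $P,Q$ be rationals with denominators not divisible by $p$ such that $p\nmid PQ(P^2-4Q)$ and $\big(\frac Qp\big)=1$. (i) If $\big(\frac{4Q-P^2}p\big)=-1$, then $\sum_{k=0}^{[p/4]}\binom{4k}{2k}\big(\frac{P^2}{64Q}\big)^k\equiv0\pmod p$. (ii) If $\big(\frac{P^2-4Q}p\big)=-1$, then $\sum_{k=0}^{[p/4]}\binom{4k}{2k}\big(\frac{Q}{4P^2}\big)^k\equiv0\pmod p$.
   Context: $[x]$ is the greatest integer not exceeding $x$. For a rational $r$ with denominator prime to $p$, $\big(\frac rp\big)$ is the Legendre symbol of its residue mod $p$; congruences are taken in the ring of such rationals, and $p\nmid r$ means $r\not\equiv0\pmod p$. *)

theory Defs
  imports Complex_Main "HOL-Number_Theory.Number_Theory"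
begin

definition p_integral :: "nat \<Rightarrow> rat \<Rightarrow> bool" where
  "p_integral p r \<longleftrightarrow> \<not> int p dvd snd (quotient_of r)"

definition rat_cong :: "nat \<Rightarrow> rat \<Rightarrow> rat \<Rightarrow> bool" where
  "rat_cong p r s \<longleftrightarrow> (\<exists>t. p_integral p t \<and> r - s = of_nat p * t)"

definition rat_residue :: "nat \<Rightarrow> rat \<Rightarrow> int" where
  "rat_residue p r = (THE a. 0 \<le> a \<and> a < int p \<and> rat_cong p r (of_int a))"

definition rat_Legendre :: "rat \<Rightarrow> nat \<Rightarrow> int" where
  "rat_Legendre r p = Legendre (rat_residue p r) (int p)"

lemma p_integral_iff:
  assumes "prime p"
  shows "p_integral p r \<longleftrightarrow> (\<exists>a b. \<not> int p dvd b \<and> r = of_int a / of_int b)"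
proof
  assume "p_integral p r"
  then show "\<exists>a b. \<not> int p dvd b \<and> r = of_int a / of_int b"
    unfolding p_integral_def by (metis prod.collapse quotient_of_div)
next
  assume "\<exists>a b. \<not> int p dvd b \<and> r = of_int a / of_int b"
  then obtain a b where b: "\<not> int p dvd b" and r: "r = of_int a / of_int b" by blast
  obtain c d where cd: "quotient_of r = (c, d)" by (cases "quotient_of r")
  have d: "d > 0" "coprime c d" and rcd: "r = of_int c / of_int d"
    using cd quotient_of_denom_pos quotient_of_coprime quotient_of_div by auto
  have "b \<noteq> 0" using b by auto
  then have "(of_int (a * d) :: rat) = of_int (c * b)"
    using r rcd d(1) by (simp add: field_simps)
  then have "a * d = c * b" by (simp only: of_int_eq_iff)
  then have "d dvd c * b" by (metis dvd_triv_right)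
  then have "d dvd b" using d(2) by (simp add: coprime_commute coprime_dvd_mult_right_iff)
  then have "\<not> int p dvd d" using b dvd_trans by blast
  then show "p_integral p r" by (simp add: p_integral_def cd)
qed

text \<open>The definite description in the definition of the residue is well defined.\<close>

lemma rat_residue_ex1:
  assumes "prime p" "p_integral p r"
  shows "\<exists>!a. 0 \<le> a \<and> a < int p \<and> rat_cong p r (of_int a)"
proof -
  obtain c d where d: "\<not> int p dvd d" and r: "r = of_int c / of_int d"
    using assms p_integral_iff by blast
  have d0: "d \<noteq> 0" using d by auto
  have p0: "int p > 0" using assms(1) by (simp add: prime_gt_0_nat)
  have pp: "prime (int p)" using assms(1) by simp
  have cop: "coprime d (int p)"
    using d pp by (metis coprime_commute prime_imp_coprime)
  have iff: "rat_cong p r (of_int a) \<longleftrightarrow> int p dvd c - a * d" for a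
  proof
    assume "rat_cong p r (of_int a)"
    then obtain t where t: "p_integral p t" "r - of_int a = of_nat p * t"
      unfolding rat_cong_def by blast
    then obtain u v where v: "\<not> int p dvd v" and tu: "t = of_int u / of_int v"
      using assms(1) p_integral_iff by blast
    have v0: "v \<noteq> 0" using v by auto
    have "(of_int ((c - a * d) * v) :: rat) = of_int (int p * (u * d))"
      using t(2) unfolding r tu using d0 v0 by (simp add: field_simps)
    then have "(c - a * d) * v = int p * (u * d)" by (simp only: of_int_eq_iff)
    then have "int p dvd (c - a * d) * v" by simp
    then show "int p dvd c - a * d" using v pp by (simp add: prime_dvd_mult_iff)
  next
    assume "int p dvd c - a * d"
    then obtain u where u: "c - a * d = int p * u" by blast
    then have "c = int p * u + a * d" by simp
    then have "r - of_int a = of_nat p * (of_int u / of_int d)"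
      unfolding r using d0 by (simp add: field_simps)
    moreover have "p_integral p (of_int u / of_int d)"
      using d assms(1) p_integral_iff by blast
    ultimately show "rat_cong p r (of_int a)" unfolding rat_cong_def by blast
  qed
  obtain e where e: "[d * e = 1] (mod int p)"
    using cop cong_solve_coprime_int by blast
  show ?thesis
  proof (rule ex1I)
    let ?a = "(c * e) mod int p"
    have "[?a * d = c * e * d] (mod int p)" by (simp add: cong_def mod_mult_left_eq)
    also have "[c * e * d = c * 1] (mod int p)"
      using cong_scalar_left[OF e, of c] by (simp add: ac_simps)
    finally have "[c = ?a * d] (mod int p)" by (simp add: cong_sym)
    then show "0 \<le> ?a \<and> ?a < int p \<and> rat_cong p r (of_int ?a)"
      using p0 by (simp add: iff cong_iff_dvd_diff)
  next
    fix b assume b: "0 \<le> b \<and> b < int p \<and> rat_cong p r (of_int b)"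
    then have "[c = b * d] (mod int p)" by (simp add: iff cong_iff_dvd_diff)
    then have "[c * e = b * d * e] (mod int p)" by (rule cong_scalar_right)
    also have "[b * d * e = b * 1] (mod int p)"
      using cong_scalar_left[OF e, of b] by (simp add: ac_simps)
    finally show "b = (c * e) mod int p" using b by (simp add: cong_def)
  qed
qed

end

theory Submission
  imports Defs
begin

text \<open>Write \<open>n = (p - 1) / 2\<close>. Modulo \<open>p\<close> the central binomial coefficient of \<open>2j\<close> is
  \<open>(-4)\<^sup>j\<close> times \<open>n choose j\<close>, so the sum over \<open>x\<^sup>k\<close> becomes the even part of a binomial
  expansion. If \<open>16 x = (m / d)\<^sup>2\<close>, twice the sum is therefore \<open>((d + m)\<^sup>n + (d - m)\<^sup>n) / d\<^sup>n\<close>.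
  By Euler's criterion this numerator is the sum of the Legendre symbols of \<open>d + m\<close> and
  \<open>d - m\<close>, which cancel when \<open>d\<^sup>2 - m\<^sup>2\<close> is a non-residue. With \<open>Q = q\<^sup>2\<close>, part (i) is the
  case \<open>(d, m) = (2 q, P)\<close> and part (ii) the case \<open>(d, m) = (P, 2 q)\<close>.\<close>

section \<open>Central binomial coefficients modulo an odd prime\<close>

lemma central_binomial_Suc:
  "Suc m * ((2 * Suc m) choose Suc m) = 2 * (2 * m + 1) * ((2 * m) choose m)"
proof -
  have a: "Suc m * (Suc (Suc (2 * m)) choose Suc m) = Suc (Suc (2 * m)) * (Suc (2 * m) choose m)"
    using Suc_times_binomial_eq by (metis mult.commute)
  have b: "Suc m * (Suc (2 * m) choose Suc m) = Suc (2 * m) * ((2 * m) choose m)"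
    using Suc_times_binomial_eq by (metis mult.commute)
  have c: "Suc (2 * m) choose Suc m = Suc (2 * m) choose m"
    using binomial_symmetric[of "Suc m" "Suc (2 * m)"] by simp
  have "Suc m * (Suc (Suc (2 * m)) choose Suc m) = 2 * (Suc m * (Suc (2 * m) choose Suc m))"
    unfolding a c by simp
  then show ?thesis unfolding b by simp
qed

text \<open>Induction on \<open>m\<close>: passing from \<open>m\<close> to \<open>m + 1\<close>
  multiplies the left side by \<open>(4 * m + 2) / (m + 1)\<close> and the right side by
  \<open>-4 * (n - m) / (m + 1)\<close>. The numerators differ by \<open>4 * n + 2 = 2 * p\<close>,
  and \<open>m + 1\<close> is invertible modulo \<open>p\<close> because
  \<open>m + 1 \<le> n < p\<close>.\<close>

lemma central_binomial_cong:
  fixes n m :: nat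
  assumes p: "prime p" and pn: "p = 2 * n + 1" and "m \<le> n"
  shows "[int ((2 * m) choose m) = int (n choose m) * (-4) ^ m] (mod int p)"
  using assms(3)
proof (induction m)
  case 0
  then show ?case by simp
next
  case (Suc m)
  have rec: "int (Suc m) * int (n choose Suc m) = (int n - int m) * int (n choose m)"
  proof -
    have "Suc m * (n choose Suc m) = (n - m) * (n choose m)"
      by (metis binomial_absorption binomial_absorb_comp mult.commute)
    then show ?thesis using Suc.prems by (metis Suc_leD of_nat_diff of_nat_mult)
  qed
  have "int (Suc m) * int ((2 * Suc m) choose Suc m) = (4 * int m + 2) * int ((2 * m) choose m)"
    using arg_cong[OF central_binomial_Suc[of m], of int] by (simp add: algebra_simps)
  also have "[\<dots> = (4 * int m + 2) * (int (n choose m) * (-4) ^ m)] (mod int p)"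
    using Suc by (intro cong_scalar_left) simp
  also have "[(4 * int m + 2) * (int (n choose m) * (-4) ^ m)
      = (- 4 * (int n - int m)) * (int (n choose m) * (-4) ^ m)] (mod int p)"
  proof (rule cong_scalar_right)
    have "(4 * int m + 2) - (- 4 * (int n - int m)) = int p * 2" by (simp add: pn)
    then show "[4 * int m + 2 = - 4 * (int n - int m)] (mod int p)"
      by (simp add: cong_iff_dvd_diff)
  qed
  also have "(- 4 * (int n - int m)) * (int (n choose m) * (-4) ^ m)
      = int (Suc m) * (int (n choose Suc m) * (-4) ^ Suc m)"
    using arg_cong[OF rec, of "\<lambda>t. t * (-4) ^ Suc m"] by (simp add: algebra_simps)
  finally have "[int (Suc m) * int ((2 * Suc m) choose Suc m)
      = int (Suc m) * (int (n choose Suc m) * (-4) ^ Suc m)] (mod int p)" .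
  moreover have "coprime (int (Suc m)) (int p)"
  proof -
    have "\<not> p dvd Suc m" using Suc.prems pn by (auto dest: dvd_imp_le)
    then show ?thesis
      using p by (metis coprime_commute coprime_int_iff prime_imp_coprime_nat)
  qed
  ultimately show ?case by (metis cong_mult_lcancel)
qed

text \<open>The odd powers of \<open>b\<close> cancel between the two expansions and the even ones
  double.\<close>

lemma binomial_sum_even:
  fixes a b :: "'a :: comm_ring_1"
  shows "(a + b) ^ n + (a - b) ^ n
    = 2 * (\<Sum>k = 0..n div 2. of_nat (n choose (2 * k)) * b ^ (2 * k) * a ^ (n - 2 * k))"
proof -
  let ?f = "\<lambda>j. of_nat (n choose j) * (b ^ j + (- b) ^ j) * a ^ (n - j)"
  have "(a + b) ^ n + (a - b) ^ n = (b + a) ^ n + (- b + a) ^ n"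
    by (simp add: add.commute)
  also have "\<dots> = (\<Sum>j\<le>n. ?f j)"
    unfolding binomial_ring[of b] binomial_ring[of "- b"]
    by (simp add: algebra_simps sum.distrib)
  also have "\<dots> = (\<Sum>j | j \<le> n \<and> even j. ?f j)"
    by (rule sum.mono_neutral_right) (auto simp: uminus_power_if)
  also have "\<dots> = (\<Sum>k = 0..n div 2. ?f (2 * k))"
    by (rule sum.reindex_bij_witness[of _ "\<lambda>k. 2 * k" "\<lambda>j. j div 2"]) auto
  also have "\<dots> = 2 * (\<Sum>k = 0..n div 2. of_nat (n choose (2 * k)) * b ^ (2 * k) * a ^ (n - 2 * k))"
    unfolding sum_distrib_left by (intro sum.cong refl) (simp add: algebra_simps)
  finally show ?thesis .
qed

section \<open>The sum over integers\<close>

lemma odd_prime_not_dvd_2: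
  assumes "prime p" "odd p"
  shows "\<not> int p dvd 2"
  using assms primes_dvd_imp_eq[of p 2] int_dvd_int_iff[of p 2] by auto

text \<open>The condition on \<open>x\<close> says \<open>16 * x = (m / d)^2\<close> modulo
  \<open>p\<close>, with the denominator cleared so that everything stays in the integers.\<close>

lemma central_binomial_sum_cong_0:
  fixes p :: nat and x d m :: int
  assumes p: "prime p" "odd p" and d: "\<not> int p dvd d"
    and x: "[16 * x * d\<^sup>2 = m\<^sup>2] (mod int p)"
    and L: "Legendre (d\<^sup>2 - m\<^sup>2) (int p) = -1"
  shows "[(\<Sum>k = 0..p div 4. int ((4 * k) choose (2 * k)) * x ^ k) = 0] (mod int p)"
proof -
  obtain n where pn: "p = 2 * n + 1" using p(2) oddE by blast
  have p2: "2 < int p" using p prime_ge_2_nat[of p] by (cases "p = 2") auto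
  have pp: "prime (int p)" using p(1) by simp
  have n2: "p div 4 = n div 2" "(p - 1) div 2 = n" using pn by auto
  let ?u = "(d + m) ^ n" and ?v = "(d - m) ^ n"
  let ?S = "\<Sum>k = 0..p div 4. int ((4 * k) choose (2 * k)) * x ^ k"
  have "[Legendre (d\<^sup>2 - m\<^sup>2) (int p) = (d\<^sup>2 - m\<^sup>2) ^ n] (mod int p)"
    using euler_criterion[of p "d\<^sup>2 - m\<^sup>2"] p p2 n2 by simp
  \<comment> \<open>Euler's criterion for \<open>d^2 - m^2 = (d + m) * (d - m)\<close>.\<close>
  then have uv: "[?u * ?v = -1] (mod int p)"
    unfolding L unfolding power2_eq_square square_diff_square_factored power_mult_distrib
    by (rule cong_sym)
  have nu: "\<not> int p dvd ?u"
  proof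
    assume "int p dvd ?u"
    then have "int p dvd -1" using uv by (metis cong_dvd_iff dvd_mult2)
    then show False using p2 by simp
  qed
  \<comment> \<open>By Euler's criterion \<open>?u\<close> is congruent to a Legendre symbol, which
    is nonzero and hence 1 or -1. So \<open>?u * ?u\<close> is 1 and \<open>?u * ?v\<close> is -1
    modulo \<open>p\<close>; adding them gives \<open>?u * (?u + ?v) = 0\<close>, where
    \<open>?u\<close> can be cancelled.\<close>
  let ?l = "Legendre (d + m) (int p)"
  have l: "[?l = ?u] (mod int p)"
    using euler_criterion[of p "d + m"] p p2 n2 by simp
  then have "?l \<noteq> 0" using nu by (metis cong_0_iff cong_sym)
  then have "?l * ?l = 1" by (simp add: Legendre_def split: if_splits)
  then have "[?u * ?u = 1] (mod int p)" using cong_mult[OF l l] by (metis cong_sym)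
  from cong_add[OF this uv] have "[?u * (?u + ?v) = 0] (mod int p)" by (simp add: algebra_simps)
  then have uv0: "int p dvd ?u + ?v" using nu pp by (simp add: cong_0_iff prime_dvd_mult_iff)
  \<comment> \<open>The factor \<open>d ^ n\<close> clears the denominators: since
    \<open>2 * k \<le> n\<close> in the range of summation, it supplies the
    \<open>d ^ (2 * k)\<close> that turns \<open>16 ^ k * x ^ k\<close> into
    \<open>m ^ (2 * k)\<close>.\<close>
  have "[d ^ n * ?S = (\<Sum>k = 0..n div 2. int (n choose (2 * k)) * m ^ (2 * k) * d ^ (n - 2 * k))] (mod int p)"
    unfolding sum_distrib_left n2
  proof (rule cong_sum)
    fix k assume "k \<in> {0..n div 2}"
    then have k: "2 * k \<le> n" by auto
    have dn: "d ^ n = d ^ (n - 2 * k) * (d\<^sup>2) ^ k"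
      using k by (simp flip: power_mult power_add)
    \<comment> \<open>The central coefficient with index \<open>2 * k\<close>, whose sign disappears
      because \<open>(-4) ^ (2 * k) = 16 ^ k\<close>.\<close>
    have "[int ((4 * k) choose (2 * k)) = int (n choose (2 * k)) * 16 ^ k] (mod int p)"
      using central_binomial_cong[OF p(1) pn k] by (simp add: power_mult)
    then have "[d ^ n * (int ((4 * k) choose (2 * k)) * x ^ k)
       = d ^ n * (int (n choose (2 * k)) * 16 ^ k * x ^ k)] (mod int p)"
      by (intro cong_scalar_left cong_scalar_right)
    also have "d ^ n * (int (n choose (2 * k)) * 16 ^ k * x ^ k)
       = int (n choose (2 * k)) * (16 * x * d\<^sup>2) ^ k * d ^ (n - 2 * k)"
      unfolding dn by (simp add: power_mult_distrib)
    also have "[\<dots> = int (n choose (2 * k)) * (m\<^sup>2) ^ k * d ^ (n - 2 * k)] (mod int p)"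
      using x by (intro cong_scalar_right cong_scalar_left cong_pow)
    finally show "[d ^ n * (int ((4 * k) choose (2 * k)) * x ^ k)
       = int (n choose (2 * k)) * m ^ (2 * k) * d ^ (n - 2 * k)] (mod int p)"
      by (simp add: power_mult)
  qed
  then have "[2 * (d ^ n * ?S) = ?u + ?v] (mod int p)"
    unfolding binomial_sum_even[of d m n] of_nat_id by (rule cong_scalar_left)
  then have "int p dvd 2 * (d ^ n * ?S)" using uv0 by (metis cong_dvd_iff)
  moreover have "\<not> int p dvd 2" by (rule odd_prime_not_dvd_2[OF p])
  moreover have "\<not> int p dvd d ^ n" using d pp prime_dvd_power by blast
  ultimately show ?thesis using pp by (simp add: cong_0_iff prime_dvd_mult_iff)
qed

lemma Legendre_cong:
  assumes "[a = b] (mod m)"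
  shows "Legendre a m = Legendre b m"
proof -
  have "[a = c] (mod m) \<longleftrightarrow> [b = c] (mod m)" "[c = a] (mod m) \<longleftrightarrow> [c = b] (mod m)" for c
    using assms by (metis cong_sym cong_trans)+
  then show ?thesis by (simp add: Legendre_def QuadRes_def)
qed

section \<open>Reducing p-integral rationals to integers modulo p\<close>

context
  fixes p :: nat
  assumes p: "prime p"
begin

lemma p_integral_of_int: "p_integral p (of_int a)"
  using p p_integral_iff[OF p, of "of_int a"] by (metis div_by_1 not_prime_unit of_int_1 prime_nat_int_transfer)

lemma p_integral_mult:
  assumes "p_integral p r" "p_integral p s"
  shows "p_integral p (r * s)"
proof -
  obtain a b c d where "\<not> int p dvd b" "r = of_int a / of_int b"
      "\<not> int p dvd d" "s = of_int c / of_int d"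
    using assms p_integral_iff[OF p] by metis
  then have "\<not> int p dvd b * d" "r * s = of_int (a * c) / of_int (b * d)"
    using p by (simp_all add: prime_dvd_mult_iff)
  then show ?thesis using p_integral_iff[OF p] by blast
qed

lemma p_integral_add:
  assumes "p_integral p r" "p_integral p s"
  shows "p_integral p (r + s)"
proof -
  obtain a b c d where *: "\<not> int p dvd b" "r = of_int a / of_int b"
      "\<not> int p dvd d" "s = of_int c / of_int d"
    using assms p_integral_iff[OF p] by metis
  moreover from * have "b \<noteq> 0" "d \<noteq> 0" by auto
  ultimately have "\<not> int p dvd b * d" "r + s = of_int (a * d + c * b) / of_int (b * d)"
    using p by (simp_all add: prime_dvd_mult_iff field_simps)
  then show ?thesis using p_integral_iff[OF p] by blast
qed

text \<open>From \<open>a - b = p * u / v\<close> with \<open>v\<close> prime to \<open>p\<close>,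
  primality gives that \<open>p\<close> divides \<open>a - b\<close>. This is the passage between
  the rational and the integer congruence.\<close>

lemma rat_cong_of_int_iff:
  "rat_cong p (of_int a) (of_int b) \<longleftrightarrow> [a = b] (mod int p)"
proof
  assume "rat_cong p (of_int a) (of_int b)"
  then obtain t where "p_integral p t" and t: "(of_int a :: rat) - of_int b = of_nat p * t"
    unfolding rat_cong_def by blast
  then obtain u v where v: "\<not> int p dvd v" and tu: "t = of_int u / of_int v"
    using p_integral_iff[OF p] by blast
  have "v \<noteq> 0" using v by auto
  then have "(of_int ((a - b) * v) :: rat) = of_int (int p * u)"
    using t unfolding tu by (simp add: field_simps)
  then have "(a - b) * v = int p * u" by (simp only: of_int_eq_iff)
  then have "int p dvd (a - b) * v" by simp
  then show "[a = b] (mod int p)" using v p by (simp add: prime_dvd_mult_iff cong_iff_dvd_diff)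
next
  assume "[a = b] (mod int p)"
  then obtain u where "a - b = int p * u" by (auto simp: cong_iff_dvd_diff)
  then have "(of_int a :: rat) - of_int b = of_nat p * of_int u"
    by (metis of_int_diff of_int_mult of_int_of_nat_eq)
  then show "rat_cong p (of_int a) (of_int b)"
    unfolding rat_cong_def using p_integral_of_int by blast
qed

lemma rat_cong_sym: "rat_cong p r s \<Longrightarrow> rat_cong p s r"
  unfolding rat_cong_def
  by (metis minus_diff_eq mult_minus_right mult_minus1 p_integral_mult p_integral_of_int
      of_int_minus of_int_1)

lemma rat_cong_trans: "rat_cong p r s \<Longrightarrow> rat_cong p s t \<Longrightarrow> rat_cong p r t"
  unfolding rat_cong_def
  by (metis diff_add_cancel add_diff_eq distrib_left p_integral_add)

text \<open>From here on the arithmetic rules carry integer representatives on the right. Their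
  existence already makes \<open>r\<close> and \<open>s\<close> p-integral, so no separate
  integrality assumptions accumulate.\<close>

lemma rat_cong_add:
  assumes "rat_cong p r (of_int a)" "rat_cong p s (of_int b)"
  shows "rat_cong p (r + s) (of_int (a + b))"
proof -
  obtain t u where "p_integral p t" "p_integral p u"
      "r - of_int a = of_nat p * t" "s - of_int b = of_nat p * u"
    using assms unfolding rat_cong_def by blast
  then have "p_integral p (t + u)" "r + s - of_int (a + b) = of_nat p * (t + u)"
    using p_integral_add by (simp_all add: algebra_simps)
  then show ?thesis unfolding rat_cong_def by blast
qed

lemma rat_cong_mult:
  assumes "rat_cong p r (of_int a)" "rat_cong p s (of_int b)"
  shows "rat_cong p (r * s) (of_int (a * b))"
proof -
  obtain t u where tu: "p_integral p t" "p_integral p u"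
      "r - of_int a = of_nat p * t" "s - of_int b = of_nat p * u"
    using assms unfolding rat_cong_def by blast
  then have r: "r = of_int a + of_nat p * t" and s: "s = of_int b + of_nat p * u"
    by (simp_all add: algebra_simps)
  \<comment> \<open>The expansion of \<open>(a + p * t) * (b + p * u) - a * b\<close>, divided by
    \<open>p\<close>.\<close>
  let ?w = "of_int a * u + of_int b * t + of_int (int p) * (t * u)"
  have "p_integral p ?w"
    by (intro p_integral_add p_integral_mult p_integral_of_int tu)
  moreover have "r * s - of_int (a * b) = of_nat p * ?w"
    unfolding r s by (simp add: algebra_simps)
  ultimately show ?thesis unfolding rat_cong_def by blast
qed

lemma rat_cong_of_int_refl: "rat_cong p (of_int a) (of_int a)"
  by (simp add: rat_cong_of_int_iff)

lemma rat_cong_diff: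
  assumes "rat_cong p r (of_int a)" "rat_cong p s (of_int b)"
  shows "rat_cong p (r - s) (of_int (a - b))"
  using rat_cong_add[OF assms(1) rat_cong_mult[OF rat_cong_of_int_refl[of "-1"] assms(2)]] by simp

lemma rat_cong_power:
  assumes "rat_cong p r (of_int a)"
  shows "rat_cong p (r ^ k) (of_int (a ^ k))"
proof (induction k)
  case 0
  then show ?case using rat_cong_of_int_refl[of 1] by simp
next
  case (Suc k)
  then show ?case using rat_cong_mult[OF assms Suc] by simp
qed

lemma rat_cong_sum:
  assumes "\<And>k. k \<in> A \<Longrightarrow> rat_cong p (f k) (of_int (g k))"
  shows "rat_cong p (sum f A) (of_int (sum g A))"
  using assms
proof (induction A rule: infinite_finite_induct)
  case (insert x A)
  then have "rat_cong p (f x + sum f A) (of_int (g x + sum g A))"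
    by (intro rat_cong_add) auto
  then show ?case using insert.hyps by simp
qed (use rat_cong_of_int_refl[of 0] in simp_all)

lemma rat_cong_unique:
  assumes "rat_cong p r (of_int a)" "rat_cong p r (of_int b)"
  shows "[a = b] (mod int p)"
  using assms rat_cong_sym rat_cong_trans rat_cong_of_int_iff by blast

lemma rat_cong_residue:
  assumes "p_integral p r"
  shows "rat_cong p r (of_int (rat_residue p r))"
  using theI'[OF rat_residue_ex1[OF p assms]] by (simp add: rat_residue_def)

lemma p_integral_if_rat_cong:
  assumes "rat_cong p r (of_int a)"
  shows "p_integral p r"
proof -
  obtain t where t: "p_integral p t" "r - of_int a = of_nat p * t"
    using assms unfolding rat_cong_def by blast
  then have "r = of_int a + of_int (int p) * t" by (simp add: algebra_simps)
  then show ?thesis using p_integral_add p_integral_mult p_integral_of_int t(1) by blast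
qed

text \<open>Allows the symbol to be read off from any representative, such as a difference of
  squares, instead of the canonical residue.\<close>

lemma rat_Legendre_eq:
  assumes "rat_cong p r (of_int a)"
  shows "rat_Legendre r p = Legendre a (int p)"
  unfolding rat_Legendre_def
  using assms rat_cong_residue[OF p_integral_if_rat_cong[OF assms]]
  by (intro Legendre_cong rat_cong_unique)

text \<open>Writing \<open>s = c / d\<close> gives \<open>c = b * d\<close> modulo \<open>p\<close>,
  so \<open>p\<close> does not divide \<open>c\<close> and the inverse \<open>d / c\<close> is
  p-integral.\<close>

lemma p_integral_divide:
  assumes "rat_cong p r (of_int a)" "rat_cong p s (of_int b)" "\<not> int p dvd b"
  shows "p_integral p (r / s)"
proof -
  obtain c d where s: "\<not> int p dvd d" "s = of_int c / of_int d"
    using p_integral_if_rat_cong[OF assms(2)] p_integral_iff[OF p] by blast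
  have "d \<noteq> 0" using s by auto
  then have "s * of_int d = of_int c" using s by simp
  then have "[c = b * d] (mod int p)"
    using rat_cong_mult[OF assms(2) rat_cong_of_int_refl[of d]] by (simp add: rat_cong_of_int_iff flip: of_int_mult)
  then have "\<not> int p dvd c"
    using p s assms(3) by (simp add: cong_dvd_iff prime_dvd_mult_iff)
  then have "p_integral p (of_int d / of_int c)" using p_integral_iff[OF p] by blast
  then have "p_integral p (r * (of_int d / of_int c))"
    using p_integral_mult p_integral_if_rat_cong[OF assms(1)] by blast
  then show ?thesis using s by simp
qed

text \<open>Common form of both sums. \<open>N\<close> and \<open>D\<close> are required only to be
  congruent to squares, since \<open>Q\<close> need not be a square of a rational.\<close>

lemma central_binomial_sum_rat_cong_0:
  assumes "odd p"
    and N: "rat_cong p N (of_int (m\<^sup>2))" and D: "rat_cong p D (of_int (d\<^sup>2))"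
    and d: "\<not> int p dvd d" and L: "rat_Legendre (D - N) p = -1"
  shows "rat_cong p (\<Sum>k = 0..p div 4. of_nat ((4 * k) choose (2 * k)) * (N / (16 * D)) ^ k) 0"
proof -
  have "\<not> int p dvd 2 ^ 4"
    using p odd_prime_not_dvd_2[OF p \<open>odd p\<close>] by (metis prime_dvd_power prime_nat_int_transfer)
  then have "\<not> int p dvd 16 * d\<^sup>2"
    using p d by (simp add: prime_dvd_mult_iff prime_dvd_power_iff)
  moreover have D16: "rat_cong p (16 * D) (of_int (16 * d\<^sup>2))"
    using rat_cong_mult[OF rat_cong_of_int_refl[of 16] D] by simp
  ultimately have X: "p_integral p (N / (16 * D))"
    by (rule p_integral_divide[OF N, rotated])
  define x where "x = rat_residue p (N / (16 * D))"
  have xc: "rat_cong p (N / (16 * D)) (of_int x)"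
    unfolding x_def by (rule rat_cong_residue[OF X])
  \<comment> \<open>As division by zero yields 0, cancelling \<open>16 * D\<close> against the
    quotient requires this; it follows from \<open>p\<close> not dividing \<open>d\<close>.\<close>
  have "D \<noteq> 0"
  proof
    assume "D = 0"
    then have "[0 = d\<^sup>2] (mod int p)" using D rat_cong_of_int_iff[of 0 "d\<^sup>2"] by simp
    then have "int p dvd d\<^sup>2" by (metis cong_0_iff cong_sym)
    then show False using d p by (simp add: prime_dvd_power_iff)
  qed
  then have "rat_cong p N (of_int (x * (16 * d\<^sup>2)))"
    using rat_cong_mult[OF xc D16] by simp
  then have "[16 * x * d\<^sup>2 = m\<^sup>2] (mod int p)"
    using rat_cong_unique[OF _ N] by (simp add: ac_simps)
  moreover have "Legendre (d\<^sup>2 - m\<^sup>2) (int p) = -1"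
    using L rat_Legendre_eq[OF rat_cong_diff[OF D N]] by simp
  ultimately have S: "[(\<Sum>k = 0..p div 4. int ((4 * k) choose (2 * k)) * x ^ k) = 0] (mod int p)"
    using central_binomial_sum_cong_0 p \<open>odd p\<close> d by blast
  have "rat_cong p (\<Sum>k = 0..p div 4. of_nat ((4 * k) choose (2 * k)) * (N / (16 * D)) ^ k)
      (of_int (\<Sum>k = 0..p div 4. int ((4 * k) choose (2 * k)) * x ^ k))"
  proof (rule rat_cong_sum)
    fix k
    show "rat_cong p (of_nat ((4 * k) choose (2 * k)) * (N / (16 * D)) ^ k)
        (of_int (int ((4 * k) choose (2 * k)) * x ^ k))"
      using rat_cong_mult[OF rat_cong_of_int_refl[of "int ((4 * k) choose (2 * k))"]
          rat_cong_power[OF xc, of k]] by simp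
  qed
  moreover have "rat_cong p (of_int (\<Sum>k = 0..p div 4. int ((4 * k) choose (2 * k)) * x ^ k)) (of_int 0)"
    unfolding rat_cong_of_int_iff by (rule S)
  ultimately show ?thesis using rat_cong_trans[of _ _ "of_int 0"] by simp
qed

end

theorem theorem2p3:
  fixes p :: nat and P Q :: rat
  assumes "prime p" and "odd p"
    and "p_integral p P" and "p_integral p Q"
    and "\<not> rat_cong p (P * Q * (P\<^sup>2 - 4 * Q)) 0"
    and "rat_Legendre Q p = 1"
  shows "(rat_Legendre (4 * Q - P\<^sup>2) p = -1 \<longrightarrow>
           rat_cong p (\<Sum>k = 0..p div 4. of_nat ((4 * k) choose (2 * k)) * (P\<^sup>2 / (64 * Q)) ^ k) 0) \<and>
         (rat_Legendre (P\<^sup>2 - 4 * Q) p = -1 \<longrightarrow>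
           rat_cong p (\<Sum>k = 0..p div 4. of_nat ((4 * k) choose (2 * k)) * (Q / (4 * P\<^sup>2)) ^ k) 0)"
proof -
  note p = \<open>prime p\<close>
  define a b where "a = rat_residue p P" and "b = rat_residue p Q"
  have a: "rat_cong p P (of_int a)" and b: "rat_cong p Q (of_int b)"
    unfolding a_def b_def using assms rat_cong_residue by blast+
  have b1: "Legendre b (int p) = 1" using assms(6) by (simp add: rat_Legendre_def b_def)
  then obtain q where q: "[q\<^sup>2 = b] (mod int p)" and b0: "\<not> [b = 0] (mod int p)"
    by (auto simp: Legendre_def QuadRes_def split: if_splits)
  \<comment> \<open>The square root \<open>q\<close> exists only modulo \<open>p\<close>; the factor
    4 goes into the square so that \<open>64 * Q = 16 * (4 * Q)\<close> fits the common
    form.\<close>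
  have "rat_cong p (of_int (4 * b)) (of_int ((2 * q)\<^sup>2))"
    unfolding rat_cong_of_int_iff[OF p] using cong_sym[OF cong_scalar_left[OF q, of 4]]
    by (simp add: power_mult_distrib)
  then have Q4: "rat_cong p (4 * Q) (of_int ((2 * q)\<^sup>2))"
    using rat_cong_trans[OF p] rat_cong_mult[OF p rat_cong_of_int_refl[OF p, of 4] b] by simp
  have P2: "rat_cong p (P\<^sup>2) (of_int (a\<^sup>2))" by (rule rat_cong_power[OF p a])
  have q2: "\<not> int p dvd 2 * q"
  proof
    assume "int p dvd 2 * q"
    then have "int p dvd q"
      using p odd_prime_not_dvd_2[OF p \<open>odd p\<close>] by (simp add: prime_dvd_mult_iff)
    then have "int p dvd q\<^sup>2" by (simp add: power2_eq_square)
    then show False using q b0 by (simp add: cong_dvd_iff cong_0_iff)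
  qed
  \<comment> \<open>If \<open>p\<close> divided \<open>a\<close>, the product
    \<open>P * Q * (P^2 - 4 * Q)\<close> would vanish modulo \<open>p\<close>.\<close>
  have a0: "\<not> int p dvd a"
  proof
    assume "int p dvd a"
    then have "[a * b * (a\<^sup>2 - (2 * q)\<^sup>2) = 0] (mod int p)" by (simp add: cong_0_iff)
    then have "rat_cong p (of_int (a * b * (a\<^sup>2 - (2 * q)\<^sup>2))) (of_int 0)"
      unfolding rat_cong_of_int_iff[OF p] .
    from rat_cong_trans[OF p rat_cong_mult[OF p rat_cong_mult[OF p a b] rat_cong_diff[OF p P2 Q4]] this]
    show False using assms(5) by simp
  qed
  \<comment> \<open>The two parts differ by exchanging \<open>P^2\<close> and \<open>4 * Q\<close>
    in the roles of \<open>N\<close> and \<open>D\<close>, which also reverses the sign of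
    \<open>D - N\<close>.\<close>
  have "16 * (4 * Q) = 64 * Q" "(4 * Q) / (16 * P\<^sup>2) = Q / (4 * P\<^sup>2)"
    by simp_all
  then show ?thesis
    using central_binomial_sum_rat_cong_0[OF p \<open>odd p\<close> P2 Q4 q2]
      central_binomial_sum_rat_cong_0[OF p \<open>odd p\<close> Q4 P2 a0] by simp
qed

end
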